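(* An element $X\in\mathfrak{sl}(3,\mathbb{R})$ generates a knotted subgroup of $SL(3,\mathbb{R})$ if and only if $X$ has a pure imaginary eigenvalue and one zero eigenvalue.
   Context: $\mathfrak{sl}(3,\mathbb{R})$ is the Lie algebra of traceless real $3\times3$ matrices. A pure imaginary number is a number of the form $i\beta$ with $0\neq\beta\in\mathbb{R}$. A subgroup $K$ of a Lie group $G$ is knotted if there is a continuous injective group homomorphism $\gamma:S^1\to G$ with continuous inverse (defined on the image) such that $\gamma(S^1)=K$. An element $X$ of the Lie algebra of $G$ generates a knotted subgroup of $G$ if the one-parameter subgroup $\phi(t)=e^{tX}$, $t\in\mathbb{R}$, is nontrivial and non-injective (so that its image is a knotted subgroup of $G$). *)

theory Defs
  imports "HOL-Analysis.Analysis"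
begin

definition sl3 :: "(real^3^3) set" where
  "sl3 = {X. trace X = 0}"

definition SL3 :: "(real^3^3) set" where
  "SL3 = {A. det A = 1}"

(* The library's (^) and exp are not available here: ( * ) on vec is componentwise. *)
primrec matrix_power :: "real^'n^'n \<Rightarrow> nat \<Rightarrow> real^'n^'n" where
  "matrix_power A 0 = mat 1"
| "matrix_power A (Suc n) = A ** matrix_power A n"

definition matrix_exp :: "real^'n^'n \<Rightarrow> real^'n^'n" where
  "matrix_exp A = (\<Sum>n. (1 / fact n) *\<^sub>R matrix_power A n)"

definition one_parameter_subgroup :: "real^'n^'n \<Rightarrow> real \<Rightarrow> real^'n^'n" where
  "one_parameter_subgroup X t = matrix_exp (t *\<^sub>R X)"

(* The first conjunct says that X belongs to the Lie algebra of the closed matrix group G,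
   i.e. that its one-parameter subgroup is a subgroup of G. *)
definition generates_knotted_subgroup :: "(real^'n^'n) set \<Rightarrow> real^'n^'n \<Rightarrow> bool" where
  "generates_knotted_subgroup G X \<longleftrightarrow>
     range (one_parameter_subgroup X) \<subseteq> G \<and>
     (\<exists>t. one_parameter_subgroup X t \<noteq> mat 1) \<and>
     \<not> inj (one_parameter_subgroup X)"

(* Eigenvalues of a real matrix are taken over the complex numbers. *)
definition eigenvalue :: "real^'n^'n \<Rightarrow> complex \<Rightarrow> bool" where
  "eigenvalue X c \<longleftrightarrow>
     (\<exists>v :: complex^'n. v \<noteq> 0 \<and> map_matrix complex_of_real X *v v = c *s v)"

definition pure_imaginary :: "complex \<Rightarrow> bool" where
  "pure_imaginary c \<longleftrightarrow> (\<exists>\<beta>::real. \<beta> \<noteq> 0 \<and> c = \<i> * complex_of_real \<beta>)"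

(* The exponential series always converges, so matrix_exp is never a junk value of suminf. *)

lemma matrix_power_entry_bound:
  fixes A :: "real^'n^'n"
  shows "\<bar>matrix_power A n $ i $ j\<bar> \<le> (real CARD('n) * norm A) ^ n"
proof (induction n arbitrary: i j)
  case 0
  show ?case by (simp add: mat_def)
next
  case (Suc n)
  let ?b = "(real CARD('n) * norm A) ^ n"
  have entry: "\<bar>A $ i $ k\<bar> \<le> norm A" for k
    using component_le_norm_cart[of "A $ i" k] Finite_Cartesian_Product.norm_nth_le[of A i]
    by simp
  have "\<bar>matrix_power A (Suc n) $ i $ j\<bar> = \<bar>\<Sum>k\<in>UNIV. A $ i $ k * matrix_power A n $ k $ j\<bar>"
    by (simp add: matrix_matrix_mult_def)
  also have "\<dots> \<le> (\<Sum>k\<in>(UNIV::'n set). \<bar>A $ i $ k * matrix_power A n $ k $ j\<bar>)"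
    by (rule sum_abs)
  also have "\<dots> \<le> (\<Sum>k\<in>(UNIV::'n set). norm A * ?b)"
    by (intro sum_mono) (simp add: abs_mult mult_mono entry Suc.IH)
  also have "\<dots> = (real CARD('n) * norm A) ^ Suc n"
    by simp
  finally show ?case .
qed

lemma matrix_exp_sums:
  fixes A :: "real^'n^'n"
  shows "(\<lambda>n. (1 / fact n) *\<^sub>R matrix_power A n) sums matrix_exp A"
proof -
  let ?c = "real CARD('n) * norm A"
  let ?f = "\<lambda>n. (1 / fact n) *\<^sub>R matrix_power A n"
  have "summable (\<lambda>n. ?f n $ i $ j)" for i j
  proof (rule summable_comparison_test')
    show "summable (\<lambda>n. ?c ^ n /\<^sub>R fact n)"
      using summable_exp_generic[of ?c] by simp
    show "norm (?f n $ i $ j) \<le> ?c ^ n /\<^sub>R fact n" for n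
      using matrix_power_entry_bound[of A n i j]
      by (simp add: abs_mult divide_simps)
  qed
  then have "(\<lambda>n. ?f n $ i $ j) sums (\<Sum>n. ?f n $ i $ j)" for i j
    by (rule summable_sums)
  then have "?f sums (\<chi> i j. \<Sum>n. ?f n $ i $ j)"
    unfolding sums_def by (intro vec_tendstoI) (simp add: sum_component)
  then show ?thesis
    unfolding matrix_exp_def by (simp add: sums_iff)
qed

end

theory Submission
  imports Defs
begin

text \<open>
  For a traceless real matrix \<open>X\<close> of size 3, let \<open>p\<close> be the sum of its principal minors of size 2.
  The eigenvalues of \<open>X\<close> are the roots of \<open>z\<^sup>3 + p z - det X\<close>
  (\<open>eigenvalue_traceless_iff\<close>), and Cayley-Hamilton turns this cubic into the relation
  \<open>X\<^sup>3 = - p X + det X\<close>. Both directions come down to recognising the case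
  \<open>det X = 0\<close>, \<open>p > 0\<close>.

  Suppose that \<open>e\<^bsup>sX\<^esup> = e\<^bsup>tX\<^esup>\<close> with \<open>s \<noteq> t\<close>. An eigenvector of \<open>X\<close> for \<open>c\<close> is one of
  \<open>e\<^bsup>tX\<^esup>\<close> for \<open>e\<^bsup>tc\<^esup>\<close>, so \<open>\<bar>e\<^bsup>sc\<^esup>\<bar> = \<bar>e\<^bsup>tc\<^esup>\<bar>\<close> and \<open>c\<close> has real part 0
  (\<open>Re_eigenvalue_eq_0_if_not_inj\<close>). The only possible real root of the cubic is therefore 0.
  A real cubic has a real root, hence \<open>det X = 0\<close>; and \<open>p < 0\<close> would give the nonzero real root
  \<open>sqrt (- p)\<close>. If \<open>p = 0\<close>, then \<open>X\<^sup>3 = 0\<close>, the exponential is a quadratic polynomial in \<open>t\<close>, and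
  one repeated value forces \<open>X = 0\<close>, against nontriviality
  (\<open>nilpotent_one_parameter_subgroup_trivial_if_not_inj\<close>). So \<open>p > 0\<close>, and \<open>\<i> sqrt p\<close> is an
  eigenvalue.

  Conversely, the eigenvalues 0 and \<open>\<i> b\<close> give \<open>det X = 0\<close> and \<open>p = b\<^sup>2\<close>, hence
  \<open>X\<^sup>3 = - b\<^sup>2 X\<close>. The exponential series then sums to a formula of Rodrigues type in
  \<open>sin (b t)\<close> and \<open>cos (b t)\<close> (\<open>one_parameter_subgroup_rotation\<close>), from which periodicity and
  nontriviality can be read off. Its determinant is \<open>cos\<^sup>2 (b t) + sin\<^sup>2 (b t)\<close> by
  \<open>det_quadratic_traceless\<close>, so the one-parameter subgroup stays in the special linear group.
\<close>

section \<open>The characteristic polynomial of a matrix of size 3\<close>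

text \<open>
  The second elementary symmetric function of the eigenvalues, that is, the coefficient of \<open>z\<close>
  in the characteristic polynomial \<open>det (z - A)\<close>.
\<close>

definition principal_minor_sum :: "'a::comm_ring_1^3^3 \<Rightarrow> 'a" where
  "principal_minor_sum A =
     A$1$1 * A$2$2 - A$1$2 * A$2$1 + A$1$1 * A$3$3 - A$1$3 * A$3$1 + A$2$2 * A$3$3 - A$2$3 * A$3$2"

lemma det_diff_mat:
  fixes A :: "'a::comm_ring_1^3^3"
  shows "det (A - mat c) = det A - principal_minor_sum A * c + trace A * c\<^sup>2 - c ^ 3"
  by (simp add: det_3 principal_minor_sum_def trace_def sum_3 mat_def algebra_simps
      power3_eq_cube power2_eq_square)

lemma cayley_hamilton_3:
  fixes A :: "real^3^3"
  shows "A ** (A ** A) =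
    trace A *\<^sub>R (A ** A) - principal_minor_sum A *\<^sub>R A + det A *\<^sub>R mat 1"
  by (simp add: vec_eq_iff forall_3 matrix_matrix_mult_def sum_3 mat_def det_3 trace_def
      principal_minor_sum_def algebra_simps)

lemma eigenvalue_iff_det:
  "eigenvalue X c \<longleftrightarrow> det (map_matrix complex_of_real X - mat c) = 0"
proof -
  let ?A = "map_matrix complex_of_real X"
  have "(?A - mat c) *v v = ?A *v v - c *s v" for v
    by (simp add: vec_eq_iff matrix_vector_mult_def mat_def left_diff_distrib sum_subtractf
        if_distrib [of "\<lambda>x. x * _"] cong: if_cong)
  then have "eigenvalue X c \<longleftrightarrow> (\<exists>v. (?A - mat c) *v v = 0 \<and> v \<noteq> 0)"
    by (auto simp: eigenvalue_def)
  also have "\<dots> \<longleftrightarrow> \<not> invertible (?A - mat c)"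
    using matrix_left_invertible_ker [of "?A - mat c"]
    by (auto simp: invertible_left_inverse)
  finally show ?thesis
    by (simp add: invertible_det_nz)
qed

text \<open>The trace is the coefficient of \<open>c\<^sup>2\<close>, so only a depressed cubic remains.\<close>

lemma eigenvalue_traceless_iff:
  fixes X :: "real^3^3"
  assumes "trace X = 0"
  shows "eigenvalue X c \<longleftrightarrow>
    c ^ 3 + of_real (principal_minor_sum X) * c = of_real (det X)"
proof -
  let ?A = "map_matrix complex_of_real X"
  have "trace ?A = of_real (trace X)"
    by (simp add: trace_def map_matrix_def)
  moreover have "det ?A = of_real (det X)"
    by (simp add: det_3 map_matrix_def)
  moreover have "principal_minor_sum ?A = of_real (principal_minor_sum X)"
    by (simp add: principal_minor_sum_def map_matrix_def)
  ultimately show ?thesis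
    using det_diff_mat [of ?A c] assms
    by (auto simp: eigenvalue_iff_det diff_diff_eq add.commute)
qed

lemma depressed_cubic_real_root: "\<exists>r::real. r ^ 3 + p * r = q"
proof -
  \<comment> \<open>From \<open>M\<^sup>2 \<ge> M\<close> it follows that \<open>M\<^sup>2 + p \<ge> 1\<close>, so the odd function
    \<open>r\<^sup>3 + p r\<close> is at least \<open>M \<ge> \<bar>q\<bar>\<close> at \<open>M\<close>, and at most \<open>- \<bar>q\<bar>\<close> at \<open>- M\<close>.\<close>
  define M where "M = 1 + \<bar>p\<bar> + \<bar>q\<bar>"
  have "M \<ge> 1" "M \<ge> \<bar>q\<bar>"
    by (simp_all add: M_def)
  then have "M \<le> M * M"
    using mult_mono [of 1 M M M] by simp
  then have "M * M \<ge> 1 + \<bar>p\<bar>"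
    unfolding M_def by linarith
  then have "M * (M * M + p) \<ge> M * 1"
    using \<open>M \<ge> 1\<close> by (intro mult_left_mono) auto
  then have "M ^ 3 + p * M \<ge> \<bar>q\<bar>"
    using \<open>M \<ge> \<bar>q\<bar>\<close> by (simp add: power3_eq_cube algebra_simps)
  then have "(- M) ^ 3 + p * (- M) \<le> q" "q \<le> M ^ 3 + p * M"
    by (simp_all add: power3_eq_cube)
  moreover have "continuous_on {- M..M} (\<lambda>r. r ^ 3 + p * r)"
    by (intro continuous_intros)
  ultimately show ?thesis
    using IVT' [of "\<lambda>r. r ^ 3 + p * r" "- M" q M] \<open>M \<ge> 1\<close> by auto
qed

section \<open>Eigenvalues and the exponential series\<close>

lemma matrix_diff_ldistrib: "A ** (B - C) = A ** B - A ** C" for A :: "'a::ring_1^'n^'m"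
  by (simp add: vec_eq_iff matrix_matrix_mult_def right_diff_distrib sum_subtractf)

lemma matrix_power_scaleR: "matrix_power (t *\<^sub>R A) n = t ^ n *\<^sub>R matrix_power A n"
  by (induction n) (simp_all add: matrix_scalar_ac scalar_matrix_assoc [symmetric] mult.commute)

lemma one_parameter_subgroup_sums:
  "(\<lambda>n. (t ^ n / fact n) *\<^sub>R matrix_power X n) sums one_parameter_subgroup X t"
  using matrix_exp_sums [of "t *\<^sub>R X"]
  by (simp add: one_parameter_subgroup_def matrix_power_scaleR)

lemma matrix_power_eigenvector:
  assumes "map_matrix complex_of_real X *v v = c *s v"
  shows "map_matrix complex_of_real (matrix_power X n) *v v = c ^ n *s v"
proof (induction n)
  case 0
  have "map_matrix complex_of_real (mat 1 :: real^'a^'a) = mat 1"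
    by (simp add: vec_eq_iff map_matrix_def mat_def)
  then show ?case by simp
next
  case (Suc n)
  have "map_matrix complex_of_real (X ** B) =
      map_matrix complex_of_real X ** map_matrix complex_of_real B" for B :: "real^'a^'a"
    by (simp add: vec_eq_iff map_matrix_def matrix_matrix_mult_def)
  then show ?case
    by (simp add: Suc.IH assms flip: matrix_vector_mul_assoc)
       (simp add: assms vector_scalar_commute)
qed

lemma one_parameter_subgroup_eigenvector:
  assumes "map_matrix complex_of_real X *v v = c *s v"
  shows "map_matrix complex_of_real (one_parameter_subgroup X t) *v v = exp (of_real t * c) *s v"
proof -
  let ?E = "one_parameter_subgroup X t"
  let ?f = "\<lambda>n. (t ^ n / fact n) *\<^sub>R matrix_power X n"
  have "(\<Sum>j\<in>UNIV. of_real (?E $ i $ j) * v $ j) = exp (of_real t * c) * v $ i" for i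
  proof (rule sums_unique2)
    have entry: "(\<lambda>n. ?f n $ i $ j) sums (?E $ i $ j)" for j
      using one_parameter_subgroup_sums [of t X]
      by (intro bounded_linear.sums [OF bounded_linear_vec_nth])
    show "(\<lambda>n. \<Sum>j\<in>UNIV. of_real (?f n $ i $ j) * v $ j) sums
        (\<Sum>j\<in>UNIV. of_real (?E $ i $ j) * v $ j)"
      by (intro sums_sum sums_mult2 sums_of_real entry)
    have "(\<Sum>j\<in>UNIV. of_real (?f n $ i $ j) * v $ j) =
        (of_real t * c) ^ n /\<^sub>R fact n * v $ i" for n
    proof -
      have "(\<Sum>j\<in>UNIV. of_real (?f n $ i $ j) * v $ j) =
          of_real (t ^ n / fact n) * (map_matrix complex_of_real (matrix_power X n) *v v) $ i"
        by (simp add: matrix_vector_mult_def map_matrix_def sum_distrib_left mult_ac)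
      then show ?thesis
        by (simp add: matrix_power_eigenvector [OF assms] scaleR_conv_of_real power_mult_distrib
            divide_simps)
    qed
    then show "(\<lambda>n. \<Sum>j\<in>UNIV. of_real (?f n $ i $ j) * v $ j) sums
        (exp (of_real t * c) * v $ i)"
      using sums_mult2 [OF exp_converges [of "of_real t * c"], of "v $ i"] by simp
  qed
  then show ?thesis
    by (simp add: vec_eq_iff matrix_vector_mult_def map_matrix_def)
qed

text \<open>
  A value taken at \<open>s\<close> and \<open>t\<close> gives \<open>e\<^bsup>sc\<^esup> = e\<^bsup>tc\<^esup>\<close> on an eigenvector; the absolute values
  of the two sides are \<open>e\<^bsup>s Re c\<^esup>\<close> and \<open>e\<^bsup>t Re c\<^esup>\<close>.
\<close>

lemma Re_eigenvalue_eq_0_if_not_inj: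
  assumes "\<not> inj (one_parameter_subgroup X)" and "eigenvalue X c"
  shows "Re c = 0"
proof -
  obtain s t where st: "s \<noteq> t" "one_parameter_subgroup X s = one_parameter_subgroup X t"
    using assms(1) by (auto simp: inj_def)
  obtain v where v: "v \<noteq> 0" "map_matrix complex_of_real X *v v = c *s v"
    using assms(2) by (auto simp: eigenvalue_def)
  have "exp (of_real s * c) *s v = exp (of_real t * c) *s v"
    using st(2) by (simp only: flip: one_parameter_subgroup_eigenvector [OF v(2)])
  with v(1) have "exp (of_real s * c) = exp (of_real t * c)"
    by (metis vector_mul_rcancel)
  then have "norm (exp (of_real s * c)) = norm (exp (of_real t * c))"
    by simp
  with st(1) show ?thesis
    by simp
qed

section \<open>The nilpotent case\<close>

lemma one_parameter_subgroup_nilpotent: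
  assumes "X ** (X ** X) = 0"
  shows "one_parameter_subgroup X t = mat 1 + t *\<^sub>R X + (t\<^sup>2 / 2) *\<^sub>R (X ** X)"
proof -
  let ?f = "\<lambda>n. (t ^ n / fact n) *\<^sub>R matrix_power X n"
  have "matrix_power X (n + 3) = 0" for n
    by (induction n) (simp_all add: numeral_3_eq_3 assms)
  then have "?f n = 0" if "n \<notin> {..<3}" for n
    using that by (metis add.commute le_Suc_ex lessThan_iff not_less scaleR_zero_right)
  then have "?f sums (\<Sum>n<3. ?f n)"
    by (intro sums_finite) auto
  then show ?thesis
    using sums_unique2 [OF one_parameter_subgroup_sums [of t X]]
    by (fastforce simp: numeral_3_eq_3 numeral_2_eq_2)
qed

text \<open>
  Equal values at \<open>s \<noteq> t\<close> make a combination of \<open>X\<close> and \<open>X\<^sup>2\<close> vanish in which \<open>X\<close> has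
  the nonzero coefficient \<open>s - t\<close>. Multiplication by \<open>X\<close> leaves \<open>(s - t) X\<^sup>2 = 0\<close>, and then
  \<open>(s - t) X = 0\<close>.
\<close>

lemma nilpotent_one_parameter_subgroup_trivial_if_not_inj:
  assumes nil: "X ** (X ** X) = 0" and "\<not> inj (one_parameter_subgroup X)"
  shows "one_parameter_subgroup X u = mat 1"
proof -
  obtain s t where st: "s \<noteq> t" "one_parameter_subgroup X s = one_parameter_subgroup X t"
    using assms(2) by (auto simp: inj_def)
  then have eq: "(s - t) *\<^sub>R X + ((s\<^sup>2 - t\<^sup>2) / 2) *\<^sub>R (X ** X) = 0"
    by (simp add: one_parameter_subgroup_nilpotent [OF nil] algebra_simps diff_divide_distrib)
  have "X ** ((s - t) *\<^sub>R X + ((s\<^sup>2 - t\<^sup>2) / 2) *\<^sub>R (X ** X)) = (s - t) *\<^sub>R (X ** X)"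
    by (simp add: matrix_add_ldistrib matrix_scalar_ac scalar_matrix_assoc [symmetric] nil)
  with eq st(1) have "X ** X = 0"
    by simp
  with eq st(1) have "X = 0"
    by simp
  then show ?thesis
    using one_parameter_subgroup_nilpotent [OF nil, of u] by simp
qed

section \<open>The rotation case\<close>

text \<open>
  For a skew-symmetric matrix of size 3 this is Rodrigues' rotation formula. By the cubic relation
  \<open>X\<close> acts on its own image as a square root of \<open>- b\<^sup>2\<close>, so the series for
  \<open>e\<^bsup>tX\<^esup>\<close> reduces to the real and imaginary parts of the series for \<open>e\<^bsup>\<i>bt\<^esup>\<close>.
\<close>

lemma one_parameter_subgroup_rotation:
  assumes "b \<noteq> 0" and cube: "X ** (X ** X) = - (b\<^sup>2 *\<^sub>R X)"
  shows "one_parameter_subgroup X t =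
    mat 1 + (sin (b * t) / b) *\<^sub>R X + ((1 - cos (b * t)) / b\<^sup>2) *\<^sub>R (X ** X)"
proof -
  let ?Y = "X ** X"
  let ?z = "\<i> * of_real b"
  let ?w = "\<i> * of_real (b * t)"
  \<comment> \<open>The matrix \<open>1 + X\<^sup>2 / b\<^sup>2\<close> is the projection onto the kernel of \<open>X\<close> along its image.
    It is killed by \<open>X\<close>, hence contributes to the zeroth power only.\<close>
  have pow: "matrix_power X n = (if n = 0 then mat 1 + (1 / b\<^sup>2) *\<^sub>R ?Y else 0)
      + (Im (?z ^ n) / b) *\<^sub>R X - (Re (?z ^ n) / b\<^sup>2) *\<^sub>R ?Y" for n
  proof (induction n)
    case (Suc n)
    have "X ** (mat 1 + (1 / b\<^sup>2) *\<^sub>R ?Y) = 0"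
      using \<open>b \<noteq> 0\<close>
      by (simp add: matrix_add_ldistrib matrix_scalar_ac scalar_matrix_assoc [symmetric] cube)
    then have "X ** (if n = 0 then mat 1 + (1 / b\<^sup>2) *\<^sub>R ?Y else 0) = 0"
      by simp
    then show ?case
      using \<open>b \<noteq> 0\<close>
      by (simp add: Suc.IH matrix_add_ldistrib matrix_diff_ldistrib matrix_scalar_ac
          scalar_matrix_assoc [symmetric] cube power2_eq_square)
  qed simp
  have "(t ^ n / fact n) *\<^sub>R matrix_power X n = (if n = 0 then mat 1 + (1 / b\<^sup>2) *\<^sub>R ?Y else 0)
      + (Im (?w ^ n /\<^sub>R fact n) / b) *\<^sub>R X - (Re (?w ^ n /\<^sub>R fact n) / b\<^sup>2) *\<^sub>R ?Y" for n
  proof -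
    have "?w ^ n = of_real (t ^ n) * ?z ^ n"
      by (simp add: power_mult_distrib)
    then have "Re (?w ^ n) = t ^ n * Re (?z ^ n)" "Im (?w ^ n) = t ^ n * Im (?z ^ n)"
      by (simp_all del: of_real_power)
    then show ?thesis
      by (simp add: pow scaleR_diff_right scaleR_add_right divide_inverse mult_ac)
  qed
  moreover have "(\<lambda>n. (if n = 0 then mat 1 + (1 / b\<^sup>2) *\<^sub>R ?Y else 0)
      + (Im (?w ^ n /\<^sub>R fact n) / b) *\<^sub>R X - (Re (?w ^ n /\<^sub>R fact n) / b\<^sup>2) *\<^sub>R ?Y) sums
      (mat 1 + (1 / b\<^sup>2) *\<^sub>R ?Y + (Im (exp ?w) / b) *\<^sub>R X - (Re (exp ?w) / b\<^sup>2) *\<^sub>R ?Y)"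
    by (intro sums_add sums_diff sums_If_finite_set' sums_single sums_scaleR_left sums_divide
        sums_Im sums_Re exp_converges)
  ultimately have "one_parameter_subgroup X t =
      mat 1 + (1 / b\<^sup>2) *\<^sub>R ?Y + (Im (exp ?w) / b) *\<^sub>R X - (Re (exp ?w) / b\<^sup>2) *\<^sub>R ?Y"
    using sums_unique2 [OF one_parameter_subgroup_sums [of t X]] by simp
  then show ?thesis
    by (simp add: Im_exp Re_exp diff_divide_distrib algebra_simps)
qed

text \<open>
  The eigenvalues of \<open>A\<close> are 0 and \<open>\<plusminus> w\<close> with \<open>w\<^sup>2 = - p\<close>, where \<open>p\<close> is the sum of the
  principal minors. The determinant is the product of the values of \<open>1 + x z + y z\<^sup>2\<close> at these
  three points, that is \<open>(1 - y p + x w) (1 - y p - x w)\<close>. Written in the entries of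
  \<open>A\<close> it is a polynomial identity modulo the two hypotheses, which avoids a detour over the
  complex numbers.
\<close>

lemma det_quadratic_traceless:
  fixes A :: "real^3^3"
  assumes "trace A = 0" "det A = 0"
  shows "det (mat 1 + x *\<^sub>R A + y *\<^sub>R (A ** A)) =
    (1 - y * principal_minor_sum A)\<^sup>2 + x\<^sup>2 * principal_minor_sum A"
proof -
  have "A$3$3 = - A$1$1 - A$2$2"
    using assms by (simp add: trace_def sum_3)
  with assms(2) show ?thesis
    by (simp add: det_3 mat_def matrix_matrix_mult_def sum_3 principal_minor_sum_def) algebra
qed

section \<open>Generators of knotted subgroups\<close>

theorem corollary15:
  fixes X :: "real^3^3"
  assumes "X \<in> sl3"
  shows "generates_knotted_subgroup SL3 X \<longleftrightarrow>
    (\<exists>c. pure_imaginary c \<and> eigenvalue X c) \<and> eigenvalue X 0"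
proof
  let ?p = "principal_minor_sum X"
  have tr: "trace X = 0"
    using assms by (simp add: sl3_def)
  note eigen = eigenvalue_traceless_iff [OF tr]
  show "(\<exists>c. pure_imaginary c \<and> eigenvalue X c) \<and> eigenvalue X 0"
    if "generates_knotted_subgroup SL3 X"
  proof
    have not_inj: "\<not> inj (one_parameter_subgroup X)"
      and nontrivial: "\<exists>t. one_parameter_subgroup X t \<noteq> mat 1"
      using that by (auto simp: generates_knotted_subgroup_def)
    have real_root: "r = 0" if "r ^ 3 + ?p * r = det X" for r
    proof -
      have "eigenvalue X (of_real r)"
        unfolding eigen by (simp flip: that)
      from Re_eigenvalue_eq_0_if_not_inj [OF not_inj this] show ?thesis
        by simp
    qed
    obtain r where "r ^ 3 + ?p * r = det X"
      using depressed_cubic_real_root by blast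
    with real_root have det: "det X = 0"
      by fastforce
    then show "eigenvalue X 0"
      by (simp add: eigen)
    have "?p > 0"
    proof (rule ccontr)
      assume "\<not> ?p > 0"
      then have "sqrt (- ?p) ^ 3 + ?p * sqrt (- ?p) = det X"
        by (simp add: det power3_eq_cube)
      then have "?p = 0"
        using real_root by fastforce
      with det have "X ** (X ** X) = 0"
        by (simp add: cayley_hamilton_3 [of X] tr)
      from nilpotent_one_parameter_subgroup_trivial_if_not_inj [OF this not_inj] nontrivial
      show False
        by simp
    qed
    then have "eigenvalue X (\<i> * of_real (sqrt ?p))"
      by (simp add: eigen det power3_eq_cube algebra_simps flip: of_real_mult)
    with \<open>?p > 0\<close> show "\<exists>c. pure_imaginary c \<and> eigenvalue X c"
      by (metis less_irrefl pure_imaginary_def real_sqrt_gt_zero)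
  qed
  show "generates_knotted_subgroup SL3 X"
    if eigenvalues: "(\<exists>c. pure_imaginary c \<and> eigenvalue X c) \<and> eigenvalue X 0"
  proof -
    obtain b where b: "b \<noteq> 0" "eigenvalue X (\<i> * of_real b)"
      using eigenvalues by (auto simp: pure_imaginary_def)
    have det: "det X = 0"
      using eigenvalues by (simp add: eigen)
    have "\<i> * of_real (b * (?p - b\<^sup>2)) = 0"
      using b(2) by (simp add: eigen det power3_eq_cube power2_eq_square algebra_simps)
    then have p: "?p = b\<^sup>2"
      using \<open>b \<noteq> 0\<close> by (simp flip: of_real_power)
    then have "X ** (X ** X) = - (b\<^sup>2 *\<^sub>R X)"
      by (simp add: cayley_hamilton_3 [of X] tr det)
    note rotation = one_parameter_subgroup_rotation [OF \<open>b \<noteq> 0\<close> this]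
    have "one_parameter_subgroup X t \<in> SL3" for t
    proof -
      have "det (one_parameter_subgroup X t) = (cos (b * t))\<^sup>2 + (sin (b * t))\<^sup>2"
        unfolding rotation det_quadratic_traceless [OF tr det] p
        using \<open>b \<noteq> 0\<close> by (simp add: power_divide)
      then show ?thesis
        by (simp add: SL3_def)
    qed
    \<comment> \<open>At half a period the sine vanishes and the value is \<open>1 + 2 X\<^sup>2 / b\<^sup>2\<close>.\<close>
    moreover have "one_parameter_subgroup X (pi / b) \<noteq> mat 1"
    proof
      assume "one_parameter_subgroup X (pi / b) = mat 1"
      with \<open>b \<noteq> 0\<close> have "X ** X = 0"
        by (simp add: rotation)
      then have "b\<^sup>2 *\<^sub>R X = 0"
        using \<open>X ** (X ** X) = - (b\<^sup>2 *\<^sub>R X)\<close> by simp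
      with \<open>b \<noteq> 0\<close> p show False
        by (simp add: principal_minor_sum_def)
    qed
    moreover have "one_parameter_subgroup X (2 * pi / b) = one_parameter_subgroup X 0"
      using \<open>b \<noteq> 0\<close> by (simp add: rotation)
    then have "\<not> inj (one_parameter_subgroup X)"
      using \<open>b \<noteq> 0\<close> by (auto dest: injD)
    ultimately show ?thesis
      by (auto simp: generates_knotted_subgroup_def)
  qed
qed

end
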